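(* Let $T\in B(\mathcal H)$ be a nonselfadjoint hyponormal operator. If $\mathcal S(T,T^* )$ is an SI semigroup, then $\{0\}\neq\sigma_{ap}(T)\subset S^1\cup\{0\}$.
   Context: $\mathcal H$ is a complex Hilbert space. $T$ is hyponormal if $T^*T-TT^*\ge0$. $\sigma_{ap}(T)$ is the approximate point spectrum of $T$ and $S^1$ the unit circle in $\mathbb C$. $\mathcal S(T,T^* )$ is the multiplicative semigroup of all finite nonempty products of $T$ and $T^*$. An ideal of a semigroup $\mathcal S$ is a nonempty subset $J\subset\mathcal S$ with $XA,AX\in J$ for $A\in J$, $X\in\mathcal S$. $\mathcal S$ is an SI (selfadjoint-ideal) semigroup if every ideal $J$ of $\mathcal S$ satisfies $J^*=\{A^*:A\in J\}\subset J$. *)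

theory Defs
  imports "HOL-Analysis.Analysis"
begin

text \<open>
  Complex Hilbert spaces are rendered as a type class. The inner product is linear in its
  first argument; the norm, distance and topology are those induced by it.
\<close>

class complex_inner = real_normed_vector +
  fixes scaleC :: "complex \<Rightarrow> 'a \<Rightarrow> 'a" (infixr "*\<^sub>C" 75)
    and cinner :: "'a \<Rightarrow> 'a \<Rightarrow> complex"
  assumes scaleC_add_right: "a *\<^sub>C (x + y) = a *\<^sub>C x + a *\<^sub>C y"
    and scaleC_add_left: "(a + b) *\<^sub>C x = a *\<^sub>C x + b *\<^sub>C x"
    and scaleC_scaleC: "a *\<^sub>C b *\<^sub>C x = (a * b) *\<^sub>C x"
    and scaleC_of_real: "complex_of_real r *\<^sub>C x = r *\<^sub>R x"
    and cinner_add_left: "cinner (x + y) z = cinner x z + cinner y z"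
    and cinner_scaleC_left: "cinner (a *\<^sub>C x) y = a * cinner x y"
    and cinner_commute: "cinner y x = cnj (cinner x y)"
    and cinner_ge_zero: "0 \<le> Re (cinner x x)"
    and cinner_eq_zero_iff: "cinner x x = 0 \<longleftrightarrow> x = 0"
    and norm_eq_sqrt_cinner: "norm x = sqrt (Re (cinner x x))"

class complex_hilbert = complex_inner + banach

instantiation complex :: complex_hilbert
begin

definition scaleC_complex :: "complex \<Rightarrow> complex \<Rightarrow> complex"
  where "scaleC_complex a x = a * x"

definition cinner_complex :: "complex \<Rightarrow> complex \<Rightarrow> complex"
  where "cinner_complex x y = x * cnj y"

instance
proof
  fix x :: complex
  show "norm x = sqrt (Re (cinner x x))"
    by (simp add: cinner_complex_def cmod_def power2_eq_square)
qed (auto simp: scaleC_complex_def cinner_complex_def algebra_simps scaleR_conv_of_real)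

end

definition bounded_clinear :: "('a::complex_inner \<Rightarrow> 'b::complex_inner) \<Rightarrow> bool"
  where "bounded_clinear T \<longleftrightarrow> bounded_linear T \<and> (\<forall>c x. T (c *\<^sub>C x) = c *\<^sub>C T x)"

text \<open>
  The adjoint is unique whenever it exists, and by the Riesz representation theorem it exists
  (and is bounded) for every bounded operator on a Hilbert space. The value is only meaningful
  for such operators.
\<close>

definition cadjoint :: "('a::complex_hilbert \<Rightarrow> 'a) \<Rightarrow> 'a \<Rightarrow> 'a"
  where "cadjoint T = (THE S. \<forall>x y. cinner (T x) y = cinner x (S y))"

definition selfadjoint :: "('a::complex_hilbert \<Rightarrow> 'a) \<Rightarrow> bool"
  where "selfadjoint T \<longleftrightarrow> cadjoint T = T"

definition positive_operator :: "('a::complex_hilbert \<Rightarrow> 'a) \<Rightarrow> bool"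
  where "positive_operator A \<longleftrightarrow> (\<forall>x. cinner (A x) x \<in> \<real>\<^sub>\<ge>\<^sub>0)"

definition hyponormal :: "('a::complex_hilbert \<Rightarrow> 'a) \<Rightarrow> bool"
  where "hyponormal T \<longleftrightarrow>
    positive_operator (\<lambda>x. (cadjoint T \<circ> T) x - (T \<circ> cadjoint T) x)"

definition approximate_point_spectrum :: "('a::complex_hilbert \<Rightarrow> 'a) \<Rightarrow> complex set"
  where "approximate_point_spectrum T =
    {z. \<exists>x :: nat \<Rightarrow> 'a. (\<forall>n. norm (x n) = 1) \<and> (\<lambda>n. T (x n) - z *\<^sub>C x n) \<longlonglongrightarrow> 0}"

definition star_semigroup :: "('a::complex_hilbert \<Rightarrow> 'a) \<Rightarrow> ('a \<Rightarrow> 'a) set"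
  where "star_semigroup T =
    {foldr (\<circ>) ws id | ws. ws \<noteq> [] \<and> set ws \<subseteq> {T, cadjoint T}}"

definition semigroup_ideal :: "('a \<Rightarrow> 'a) set \<Rightarrow> ('a \<Rightarrow> 'a) set \<Rightarrow> bool"
  where "semigroup_ideal J S \<longleftrightarrow>
    J \<noteq> {} \<and> J \<subseteq> S \<and> (\<forall>A\<in>J. \<forall>X\<in>S. X \<circ> A \<in> J \<and> A \<circ> X \<in> J)"

definition SI_semigroup :: "('a::complex_hilbert \<Rightarrow> 'a) set \<Rightarrow> bool"
  where "SI_semigroup S \<longleftrightarrow> (\<forall>J. semigroup_ideal J S \<longrightarrow> cadjoint ` J \<subseteq> J)"

end

theory Submission
  imports Defs
begin

text \<open>
  The products containing \<open>T\<close> as a factor form an ideal, so \<open>T\<^sup>*\<close> is such a product; as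
  \<open>T\<^sup>* \<noteq> T\<close>, the product has length \<open>k \<ge> 2\<close>. By hyponormality, approximate eigenvectors of
  \<open>T\<close> for \<open>z\<close> are approximate eigenvectors of \<open>T\<^sup>*\<close> for the conjugate of \<open>z\<close>. Evaluating
  the product on them gives \<open>\<bar>z\<bar> = \<bar>z\<bar>\<^sup>k\<close>, whence \<open>z = 0\<close> or \<open>\<bar>z\<bar> = 1\<close>.

  A nonzero approximate eigenvalue, of modulus \<open>c = \<parallel>T\<parallel>\<close>, is found without spectral theory.
  Since \<open>\<parallel>T x\<parallel>\<^sup>2 \<le> \<parallel>T\<^sup>2 x\<parallel> \<parallel>x\<parallel>\<close>, for a unit vector \<open>x\<close> that nearly attains the norm all of
  \<open>v\<^sub>k = c\<^sup>-\<^sup>k T\<^sup>k x\<close> with \<open>k < n\<close> have norm at least \<open>1/2\<close>. For a suitable \<open>n\<close>-th root of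
  unity \<open>w\<close>, Parseval's identity makes the sum \<open>y\<close> of the \<open>w\<^sup>-\<^sup>k v\<^sub>k\<close> of norm at least
  \<open>\<surd>n / 2\<close>, while \<open>(T - c w) y\<close> telescopes to norm at most \<open>2 c\<close>. Let \<open>n\<close> tend to infinity.
\<close>

section \<open>Complex inner product spaces\<close>

lemma cinner_add_right: "cinner x (y + z) = cinner x y + cinner (x::'a::complex_inner) z"
  by (metis cinner_add_left cinner_commute complex_cnj_add)

lemma cinner_scaleC_right: "cinner x (a *\<^sub>C y) = cnj a * cinner (x::'a::complex_inner) y"
  by (metis cinner_commute cinner_scaleC_left complex_cnj_mult)

lemma cinner_scaleR_left: "cinner (r *\<^sub>R x) y = of_real r * cinner (x::'a::complex_inner) y"
  by (metis cinner_scaleC_left scaleC_of_real)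

lemma cinner_scaleR_right: "cinner x (r *\<^sub>R y) = of_real r * cinner (x::'a::complex_inner) y"
  by (metis cinner_scaleC_right complex_cnj_complex_of_real scaleC_of_real)

lemma cinner_zero_left [simp]: "cinner 0 (y::'a::complex_inner) = 0"
  using cinner_scaleR_left[of 0 0 y] by simp

lemma cinner_zero_right [simp]: "cinner (y::'a::complex_inner) 0 = 0"
  using cinner_scaleR_right[of y 0 0] by simp

lemma cinner_diff_left: "cinner (x - y) z = cinner x z - cinner (y::'a::complex_inner) z"
  using cinner_add_left[of "x - y" y z] by simp

lemma cinner_diff_right: "cinner x (y - z) = cinner x y - cinner (x::'a::complex_inner) z"
  using cinner_add_right[of x "y - z" z] by simp

lemma cinner_sum_left: "cinner (sum f A) y = (\<Sum>k\<in>A. cinner (f k) (y::'a::complex_inner))"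
  by (induction A rule: infinite_finite_induct) (auto simp: cinner_add_left)

lemma cinner_sum_right: "cinner y (sum f A) = (\<Sum>k\<in>A. cinner (y::'a::complex_inner) (f k))"
  by (induction A rule: infinite_finite_induct) (auto simp: cinner_add_right)

lemma power2_norm_eq_Re_cinner: "(norm x)\<^sup>2 = Re (cinner x (x::'a::complex_inner))"
  by (simp add: norm_eq_sqrt_cinner cinner_ge_zero)

lemma cinner_self: "cinner x (x::'a::complex_inner) = of_real ((norm x)\<^sup>2)"
proof -
  have "Im (cinner x x) = 0"
    using arg_cong[OF cinner_commute[of x x], of Im] by simp
  then show ?thesis
    by (simp add: complex_eq_iff power2_norm_eq_Re_cinner)
qed

lemma norm_scaleC: "norm (a *\<^sub>C x) = cmod a * norm (x::'a::complex_inner)"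
proof -
  have "(norm (a *\<^sub>C x))\<^sup>2 = Re ((a * cnj a) * cinner x x)"
    by (simp only: power2_norm_eq_Re_cinner cinner_scaleC_left cinner_scaleC_right mult_ac)
  also have "\<dots> = (cmod a * norm x)\<^sup>2"
    by (simp only: cinner_self complex_norm_square[symmetric] of_real_mult[symmetric]
        Re_complex_of_real power_mult_distrib)
  finally show ?thesis
    by (rule power2_eq_imp_eq) simp_all
qed

lemma Re_cinner_commute: "Re (cinner y x) = Re (cinner (x::'a::complex_inner) y)"
  by (subst cinner_commute) simp

lemma power2_norm_add:
  "(norm (x + y))\<^sup>2 = (norm x)\<^sup>2 + 2 * Re (cinner x y) + (norm (y::'a::complex_inner))\<^sup>2"
  unfolding power2_norm_eq_Re_cinner
  using Re_cinner_commute[of x y] by (simp add: cinner_add_left cinner_add_right)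

lemma power2_norm_diff:
  "(norm (x - y))\<^sup>2 = (norm x)\<^sup>2 - 2 * Re (cinner x y) + (norm (y::'a::complex_inner))\<^sup>2"
  unfolding power2_norm_eq_Re_cinner
  using Re_cinner_commute[of x y] by (simp add: cinner_diff_left cinner_diff_right)

text \<open>Cauchy--Schwarz can be read off the triangle inequality, which the type class provides.\<close>

lemma Re_cinner_le_norm: "Re (cinner x y) \<le> norm x * norm (y::'a::complex_inner)"
proof -
  have "(norm (x + y))\<^sup>2 \<le> (norm x + norm y)\<^sup>2"
    by (intro power_mono norm_triangle_ineq) simp
  then show ?thesis
    by (simp add: power2_norm_add power2_sum)
qed

lemma scaleC_one [simp]: "1 *\<^sub>C x = (x::'a::complex_inner)"
  using scaleC_of_real[of 1 x] by simp

lemma scaleC_zero_right [simp]: "a *\<^sub>C 0 = (0::'a::complex_inner)"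
  using norm_scaleC[of a 0] by simp

lemma scaleC_minus_left: "(- a) *\<^sub>C x = - (a *\<^sub>C (x::'a::complex_inner))"
  using scaleC_scaleC[of "-1" a x] scaleC_of_real[of "-1" "a *\<^sub>C x"] by simp

lemma scaleC_diff_left: "(a - b) *\<^sub>C x = a *\<^sub>C x - b *\<^sub>C (x::'a::complex_inner)"
  using scaleC_add_left[of a "- b" x] by (simp add: scaleC_minus_left)

lemma scaleC_diff_right: "a *\<^sub>C (x - y) = a *\<^sub>C x - a *\<^sub>C (y::'a::complex_inner)"
  using scaleC_add_right[of a "x - y" y] by simp

lemma scaleC_sum_right: "a *\<^sub>C sum f A = (\<Sum>k\<in>A. a *\<^sub>C (f k :: 'a::complex_inner))"
  by (induction A rule: infinite_finite_induct) (auto simp: scaleC_add_right)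

lemma scaleC_scaleR: "a *\<^sub>C r *\<^sub>R x = r *\<^sub>R a *\<^sub>C (x::'a::complex_inner)"
  by (metis mult.commute scaleC_of_real scaleC_scaleC)

lemma cinner_eqI:
  assumes "\<And>x. cinner x y = cinner x (z::'a::complex_inner)"
  shows "y = z"
  using assms[of "y - z"] cinner_eq_zero_iff[of "y - z"] by (simp add: cinner_diff_right)

section \<open>The Riesz representation theorem and adjoints\<close>

text \<open>The representing vector is the minimiser of \<open>(norm x)\<^sup>2 - 2 * f x\<close>:
  near-minimisers form a Cauchy sequence by the parallelogram law, and the first variation at their
  limit vanishes, which is the claimed identity.\<close>

lemma riesz_Re:
  fixes f :: "'a::complex_hilbert \<Rightarrow> real"
  assumes f: "bounded_linear f"
  shows "\<exists>h. \<forall>x. f x = Re (cinner x h)"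
proof -
  interpret f: bounded_linear f by fact
  define q where "q x = (norm x)\<^sup>2 - 2 * f x" for x
  define m where "m = Inf (range q)"
  have bdd: "bdd_below (range q)"
  proof -
    obtain K where K: "\<And>x. norm (f x) \<le> norm x * K"
      using f.bounded by blast
    \<comment> \<open>Complete the square in \<open>norm x\<close>, after bounding
      \<open>f x\<close> by \<open>norm x * K\<close>.\<close>
    have "- K\<^sup>2 \<le> q x" for x
    proof -
      have "0 \<le> (norm x - K)\<^sup>2" "f x \<le> norm x * K"
        using K[of x] by auto
      then show ?thesis
        unfolding q_def by (simp add: power2_diff)
    qed
    then show ?thesis by (auto simp: bdd_below_def)
  qed
  have m_le: "m \<le> q x" for x
    unfolding m_def using bdd by (simp add: cInf_lower)
  have "\<exists>x. q x < m + 1 / real (Suc n)" for n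
  proof -
    have "Inf (range q) < m + 1 / real (Suc n)"
      by (simp add: m_def)
    then show ?thesis
      using cInf_lessD[of "range q"] by blast
  qed
  then obtain X where X: "\<And>n. q (X n) < m + 1 / real (Suc n)"
    by metis
  \<comment> \<open>Parallelogram law for \<open>x\<close> and \<open>y\<close>, with
    \<open>m\<close> as the lower bound of \<open>q\<close> at their midpoint.\<close>
  have par: "(norm (x - y))\<^sup>2 \<le> 2 * (q x - m) + 2 * (q y - m)" for x y
  proof -
    have "q ((1/2) *\<^sub>R (x + y)) = (norm (x + y))\<^sup>2 / 4 - (f x + f y)"
      by (simp add: q_def power_divide f.scaleR f.add add_divide_distrib)
    moreover have "(norm (x + y))\<^sup>2 + (norm (x - y))\<^sup>2 = 2 * (norm x)\<^sup>2 + 2 * (norm y)\<^sup>2"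
      by (simp add: power2_norm_diff power2_norm_add)
    ultimately have "(norm (x - y))\<^sup>2 = 2 * q x + 2 * q y - 4 * q ((1/2) *\<^sub>R (x + y))"
      unfolding q_def by simp
    with m_le[of "(1/2) *\<^sub>R (x + y)"] show ?thesis by simp
  qed
  have "Cauchy X"
  proof (rule CauchyI)
    fix e :: real assume "e > 0"
    \<comment> \<open>From index \<open>N\<close> on, \<open>q\<close> exceeds \<open>m\<close> by
      less than \<open>e\<^sup>2 / 4\<close>; the right side of \<open>par\<close> is then below
      \<open>e\<^sup>2\<close>.\<close>
    then obtain N where N: "1 / real (Suc N) < e\<^sup>2 / 4"
      using nat_approx_posE[of "e\<^sup>2 / 4"] by auto
    have "norm (X i - X j) < e" if "i \<ge> N" "j \<ge> N" for i j
    proof -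
      have le: "1 / real (Suc i) \<le> 1 / real (Suc N)" "1 / real (Suc j) \<le> 1 / real (Suc N)"
        using that by (auto simp: frac_le)
      have "q (X i) < m + e\<^sup>2 / 4" "q (X j) < m + e\<^sup>2 / 4"
        using less_trans[OF X add_strict_left_mono[OF le_less_trans[OF _ N]]] le by blast+
      then have "(norm (X i - X j))\<^sup>2 < e\<^sup>2"
        using par[of "X i" "X j"] by argo
      then show ?thesis
        using \<open>e > 0\<close> by (simp add: power_less_imp_less_base)
    qed
    then show "\<exists>N. \<forall>i\<ge>N. \<forall>j\<ge>N. norm (X i - X j) < e" by blast
  qed
  then obtain h where h: "X \<longlonglongrightarrow> h"
    using Cauchy_convergent convergent_def by blast
  have "(\<lambda>n. q (X n)) \<longlonglongrightarrow> q h"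
    unfolding q_def by (intro tendsto_intros f.tendsto h)
  moreover have "(\<lambda>n. m + 1 / real (Suc n)) \<longlonglongrightarrow> m + 0"
    by (intro tendsto_intros LIMSEQ_Suc[OF lim_1_over_n])
  ultimately have "q h \<le> m + 0"
    using X by (intro LIMSEQ_le) (auto intro!: exI[of _ 0] less_imp_le)
  then have min: "q h \<le> q x" for x
    using m_le[of x] by simp
  have "f x = Re (cinner x h)" for x
  proof (rule ccontr)
    define d where "d = f x - Re (cinner x h)"
    assume "f x \<noteq> Re (cinner x h)"
    then have d: "d \<noteq> 0" by (simp add: d_def)
    \<comment> \<open>Moving from \<open>h\<close> by \<open>t *\<^sub>R x\<close> changes
      \<open>q\<close> by \<open>- 2 * t * d + t\<^sup>2 * (norm x)\<^sup>2\<close>, which is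
      negative for this \<open>t\<close>. The added 1 keeps the denominator positive when
      \<open>x = 0\<close>.\<close>
    define t where "t = d / ((norm x)\<^sup>2 + 1)"
    have pos: "(norm x)\<^sup>2 + 1 > 0"
      by (smt (verit) zero_le_power2)
    have "q (h + t *\<^sub>R x) = q h - 2 * t * d + t\<^sup>2 * (norm x)\<^sup>2"
      unfolding q_def d_def
      by (simp add: power2_norm_add f.add f.scaleR cinner_scaleR_right power_mult_distrib
          Re_cinner_commute[of h x] algebra_simps)
    with min[of "h + t *\<^sub>R x"] have "2 * t * d \<le> t\<^sup>2 * (norm x)\<^sup>2" by simp
    also have "\<dots> \<le> t\<^sup>2 * ((norm x)\<^sup>2 + 1)"
      by (intro mult_left_mono) auto
    also have "\<dots> = t * d"
      using pos by (simp add: t_def power2_eq_square)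
    finally have "t * d \<le> 0" by (simp add: mult.commute)
    moreover have "t * d > 0"
      using d pos by (simp add: t_def power2_eq_square[symmetric])
    ultimately show False by simp
  qed
  then show ?thesis by blast
qed

lemma bounded_clinear_imp_bounded_linear: "bounded_clinear T \<Longrightarrow> bounded_linear T"
  by (simp add: bounded_clinear_def)

lemma bounded_clinear_scaleC: "bounded_clinear T \<Longrightarrow> T (c *\<^sub>C x) = c *\<^sub>C T x"
  by (simp add: bounded_clinear_def)

text \<open>Riesz is applied to the real part of \<open>cinner (T x) y\<close> as a real functional
  of \<open>x\<close>; complex linearity then recovers the imaginary part.\<close>

lemma adjoint_exists:
  fixes T :: "'a::complex_hilbert \<Rightarrow> 'a"
  assumes T: "bounded_clinear T"
  shows "\<exists>h. \<forall>x. cinner (T x) y = cinner x h"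
proof -
  interpret T: bounded_linear T
    using T by (rule bounded_clinear_imp_bounded_linear)
  obtain K where K: "\<And>x. norm (T x) \<le> norm x * K"
    using T.bounded by blast
  have "bounded_linear (\<lambda>x. Re (cinner (T x) y))"
  proof (rule bounded_linear_intro)
    fix x
    \<comment> \<open>The bound on the absolute value is the one-sided Cauchy--Schwarz inequality
      for both \<open>T x\<close> and \<open>- T x\<close>.\<close>
    have "\<bar>Re (cinner (T x) y)\<bar> \<le> norm (T x) * norm y"
      using Re_cinner_le_norm[of "T x" y] Re_cinner_le_norm[of "- T x" y]
        cinner_diff_left[of 0 "T x" y] by simp
    also have "\<dots> \<le> norm x * K * norm y"
      using K[of x] by (rule mult_right_mono) simp
    finally show "norm (Re (cinner (T x) y)) \<le> norm x * (K * norm y)"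
      by (simp add: mult.assoc)
  qed (simp_all add: T.add T.scaleR cinner_add_left cinner_scaleR_left)
  then obtain h where h: "\<And>x. Re (cinner (T x) y) = Re (cinner x h)"
    using riesz_Re by metis
  have "Im (cinner (T x) y) = Im (cinner x h)" for x
    \<comment> \<open>At \<open>\<i> *\<^sub>C x\<close> both inner products are multiplied by
      \<open>\<i>\<close>, so their real parts become the negated imaginary parts.\<close>
    using h[of "\<i> *\<^sub>C x"] by (simp add: bounded_clinear_scaleC[OF T] cinner_scaleC_left)
  with h show ?thesis
    by (auto simp: complex_eq_iff)
qed

text \<open>Gives the definite description its meaning: a candidate exists by
  \<open>adjoint_exists\<close>, and it is unique because vectors with equal inner products
  coincide.\<close>

lemma cadjoint:
  fixes T :: "'a::complex_hilbert \<Rightarrow> 'a"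
  assumes "bounded_clinear T"
  shows "cinner (T x) y = cinner x (cadjoint T y)"
proof -
  obtain S where S: "\<And>x y. cinner (T x) y = cinner x (S y)"
    using adjoint_exists[OF assms] by metis
  have "\<forall>x y. cinner (T x) y = cinner x (cadjoint T y)"
    unfolding cadjoint_def
  proof (rule theI[of "\<lambda>S. \<forall>x y. cinner (T x) y = cinner x (S y)" S])
    show "\<forall>x y. cinner (T x) y = cinner x (S y)" using S by blast
  next
    fix S' assume S': "\<forall>x y. cinner (T x) y = cinner x (S' y)"
    show "S' = S"
      by (rule ext, rule cinner_eqI) (metis S S')
  qed
  then show ?thesis by blast
qed

lemma cadjoint':
  fixes T :: "'a::complex_hilbert \<Rightarrow> 'a"
  assumes "bounded_clinear T"
  shows "cinner (cadjoint T x) y = cinner x (T y)"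
  by (metis assms cadjoint cinner_commute)

lemma bounded_clinear_cadjoint:
  fixes T :: "'a::complex_hilbert \<Rightarrow> 'a"
  assumes T: "bounded_clinear T"
  shows "bounded_clinear (cadjoint T)"
proof -
  interpret T: bounded_linear T
    using T by (rule bounded_clinear_imp_bounded_linear)
  obtain K where K: "\<And>x. norm (T x) \<le> norm x * K"
    using T.bounded by blast
  have add: "cadjoint T (x + y) = cadjoint T x + cadjoint T y" for x y
    by (rule cinner_eqI) (simp add: cadjoint[OF T, symmetric] cinner_add_right)
  have scale: "cadjoint T (c *\<^sub>C x) = c *\<^sub>C cadjoint T x" for c x
    by (rule cinner_eqI) (simp add: cadjoint[OF T, symmetric] cinner_scaleC_right)
  have bound: "norm (cadjoint T x) \<le> norm x * K" for x
  \<comment> \<open>The estimate of \<open>(norm (cadjoint T x))\<^sup>2\<close> yields the bound by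
    cancelling one factor \<open>norm (cadjoint T x)\<close>, so the value 0 is treated
    apart.\<close>
  proof (cases "cadjoint T x = 0")
    case True
    then show ?thesis using order_trans[OF norm_ge_zero K[of x]] by simp
  next
    case False
    have "(norm (cadjoint T x))\<^sup>2 = Re (cinner (T (cadjoint T x)) x)"
      by (simp add: power2_norm_eq_Re_cinner cadjoint[OF T])
    also have "\<dots> \<le> norm (T (cadjoint T x)) * norm x"
      by (rule Re_cinner_le_norm)
    also have "\<dots> \<le> norm (cadjoint T x) * K * norm x"
      using K by (rule mult_right_mono) simp
    finally show ?thesis
      using False by (simp add: power2_eq_square mult_ac)
  qed
  have "bounded_linear (cadjoint T)"
    using add bound scale[of "of_real _"] by (intro bounded_linear_intro[of _ K]) (auto simp: scaleC_of_real)
  with scale show ?thesis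
    by (simp add: bounded_clinear_def)
qed

section \<open>Hyponormal operators\<close>

text \<open>The quadratic form in the definition of hyponormality equals
  \<open>(norm (T x))\<^sup>2 - (norm (cadjoint T x))\<^sup>2\<close>.\<close>

lemma hyponormal_norm_cadjoint_le:
  fixes T :: "'a::complex_hilbert \<Rightarrow> 'a"
  assumes T: "bounded_clinear T" and "hyponormal T"
  shows "norm (cadjoint T x) \<le> norm (T x)"
proof -
  have "0 \<le> Re (cinner (cadjoint T (T x) - T (cadjoint T x)) x)"
    using assms(2) by (auto simp: hyponormal_def positive_operator_def complex_nonneg_Reals_iff)
  then have "(norm (cadjoint T x))\<^sup>2 \<le> (norm (T x))\<^sup>2"
    by (simp add: cinner_diff_left power2_norm_eq_Re_cinner cadjoint[OF T] cadjoint'[OF T])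
  then show ?thesis by (rule power2_le_imp_le) simp
qed

text \<open>Hyponormality survives translation by a scalar: when both squares are expanded, the
  cross terms have equal real parts and the last terms agree, since \<open>z\<close> and
  \<open>cnj z\<close> have the same modulus.\<close>

lemma hyponormal_shift:
  fixes T :: "'a::complex_hilbert \<Rightarrow> 'a"
  assumes T: "bounded_clinear T" and "hyponormal T"
  shows "norm (cadjoint T x - cnj z *\<^sub>C x) \<le> norm (T x - z *\<^sub>C x)"
proof -
  have "Re (cinner (cadjoint T x) (cnj z *\<^sub>C x)) = Re (cinner (T x) (z *\<^sub>C x))"
    by (subst (2) Re_cinner_commute[symmetric])
      (simp add: cinner_scaleC_left cinner_scaleC_right cadjoint'[OF T])
  moreover have "(norm (cadjoint T x))\<^sup>2 \<le> (norm (T x))\<^sup>2"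
    using hyponormal_norm_cadjoint_le[OF assms] by (simp add: power_mono)
  ultimately have "(norm (cadjoint T x - cnj z *\<^sub>C x))\<^sup>2 \<le> (norm (T x - z *\<^sub>C x))\<^sup>2"
    by (simp add: power2_norm_diff norm_scaleC)
  then show ?thesis by (rule power2_le_imp_le) simp
qed

text \<open>Cauchy--Schwarz for \<open>cadjoint T (T x)\<close> and \<open>x\<close>, followed by
  the comparison of \<open>cadjoint T\<close> with \<open>T\<close> at the vector
  \<open>T x\<close>. The search for a nonzero approximate eigenvalue uses hyponormality through
  this inequality.\<close>

lemma hyponormal_imp_paranormal:
  fixes T :: "'a::complex_hilbert \<Rightarrow> 'a"
  assumes T: "bounded_clinear T" and "hyponormal T"
  shows "(norm (T x))\<^sup>2 \<le> norm (T (T x)) * norm x"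
proof -
  have "(norm (T x))\<^sup>2 = Re (cinner (cadjoint T (T x)) x)"
    by (simp add: power2_norm_eq_Re_cinner cadjoint'[OF T])
  also have "\<dots> \<le> norm (cadjoint T (T x)) * norm x"
    by (rule Re_cinner_le_norm)
  also have "\<dots> \<le> norm (T (T x)) * norm x"
    using hyponormal_norm_cadjoint_le[OF assms] by (rule mult_right_mono) simp
  finally show ?thesis .
qed

section \<open>Approximate eigenvalues of maximal modulus\<close>

text \<open>Orthogonality of the characters of the cyclic group of order \<open>n\<close>. The
  summands are the powers of one \<open>n\<close>-th root of unity \<open>w\<close>, so the
  geometric sum vanishes unless \<open>w = 1\<close>.\<close>

lemma sum_cis_roots_of_unity:
  assumes "k < n" "l < n"
  shows "(\<Sum>j<n. cis (2 * pi * real j / real n) ^ l * cnj (cis (2 * pi * real j / real n) ^ k))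
    = (if k = l then of_nat n else 0)"
proof -
  define w where "w = cis (2 * pi * (real l - real k) / real n)"
  have n: "n > 0" using assms by simp
  have "cis (2 * pi * real j / real n) ^ l * cnj (cis (2 * pi * real j / real n) ^ k) = w ^ j" for j
    unfolding w_def by (simp add: Complex.DeMoivre cis_cnj cis_mult) (simp add: field_simps diff_divide_distrib)
  then have eq: "(\<Sum>j<n. cis (2 * pi * real j / real n) ^ l * cnj (cis (2 * pi * real j / real n) ^ k))
      = (\<Sum>j<n. w ^ j)" by simp
  show ?thesis
  proof (cases "k = l")
    case True
    then show ?thesis unfolding eq by (simp add: w_def)
  next
    case False
    have "w ^ n = cis (2 * pi * (real_of_int (int l - int k)))"
      unfolding w_def using n by (simp add: Complex.DeMoivre)
    also have "\<dots> = 1"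
      by (simp add: cis_multiple_2pi)
    finally have "w ^ n = 1" .
    moreover have "w \<noteq> 1"
    proof
      \<comment> \<open>Then \<open>n\<close> would divide \<open>l - k\<close>, a nonzero integer
        of absolute value below \<open>n\<close>.\<close>
      assume "w = 1"
      then have "cos (2 * pi * (real l - real k) / real n) = 1"
        by (simp add: w_def complex_eq_iff)
      then obtain i :: int where "2 * pi * (real l - real k) / real n = real_of_int i * (2 * pi)"
        using cos_one_2pi_int by (auto simp: mult.assoc)
      then have "(2 * pi) * (real l - real k) = (2 * pi) * (real_of_int i * real n)"
        using n by (simp add: divide_eq_eq mult_ac)
      then have "real l - real k = real_of_int i * real n"
        by (simp only: mult_cancel_left) simp
      then have *: "int l - int k = i * int n"
        by (simp only: of_int_eq_iff[where 'a = real, symmetric]) simp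
      then have "int n dvd int l - int k" by simp
      moreover have "\<bar>int l - int k\<bar> < int n" "int l - int k \<noteq> 0"
        using assms False by auto
      ultimately show False
        using dvd_imp_le_int[of "int l - int k" "int n"] by linarith
    qed
    ultimately show ?thesis unfolding eq using False by (simp add: geometric_sum)
  qed
qed

text \<open>Expand the squared norms and sum over \<open>j\<close> first: by orthogonality of
  characters only the diagonal terms \<open>k = l\<close> survive, each with weight
  \<open>n\<close>.\<close>

lemma parseval_roots_of_unity:
  fixes v :: "nat \<Rightarrow> 'a::complex_inner"
  shows "(\<Sum>j<n. (norm (\<Sum>k<n. (cis (2 * pi * real j / real n) ^ k) *\<^sub>C v k))\<^sup>2)
    = real n * (\<Sum>k<n. (norm (v k))\<^sup>2)"
proof -
  let ?w = "\<lambda>j. cis (2 * pi * real j / real n)"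
  have "complex_of_real (\<Sum>j<n. (norm (\<Sum>k<n. (?w j ^ k) *\<^sub>C v k))\<^sup>2)
      = (\<Sum>j<n. \<Sum>k<n. \<Sum>l<n. (?w j ^ l * cnj (?w j ^ k)) * cinner (v l) (v k))"
    by (simp only: of_real_sum cinner_self[symmetric] cinner_sum_left cinner_sum_right
        cinner_scaleC_left cinner_scaleC_right sum_distrib_left mult_ac)
  also have "\<dots> = (\<Sum>k<n. \<Sum>l<n. (\<Sum>j<n. ?w j ^ l * cnj (?w j ^ k)) * cinner (v l) (v k))"
    unfolding sum_distrib_right
    by (subst sum.swap, rule sum.cong[OF refl], rule sum.swap)
  also have "\<dots> = (\<Sum>k<n. \<Sum>l<n. if k = l then of_nat n * cinner (v l) (v k) else 0)"
    by (intro sum.cong refl, subst sum_cis_roots_of_unity) auto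
  also have "\<dots> = of_real (real n * (\<Sum>k<n. (norm (v k))\<^sup>2))"
    by (simp add: cinner_self sum_distrib_left)
  finally show ?thesis by (simp only: of_real_eq_iff)
qed

text \<open>The bound \<open>4 * c / sqrt n\<close> is the telescoped error, at most
  \<open>2 * c\<close>, divided by the norm of the weighted orbit sum, at least
  \<open>sqrt n / 2\<close>.\<close>

lemma approximate_eigenvector_of_orbit:
  fixes T :: "'a::complex_hilbert \<Rightarrow> 'a"
  assumes T: "bounded_clinear T" and n: "n > 0" and c: "c \<ge> 0"
    and orbit: "\<And>k. T (v k) = c *\<^sub>R v (Suc k)"
    and ends: "norm (v 0) \<le> 1" "norm (v n) \<le> 1"
    and large: "\<And>k. k < n \<Longrightarrow> norm (v k) \<ge> 1 / 2"
  shows "\<exists>w u. cmod w = 1 \<and> norm u = 1 \<and> norm (T u - (of_real c * w) *\<^sub>C u) \<le> 4 * c / sqrt n"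
proof -
  interpret T: bounded_linear T
    using T by (rule bounded_clinear_imp_bounded_linear)
  define a where "a j = cis (2 * pi * real j / real n)" for j
  define y where "y j = (\<Sum>k<n. (a j ^ k) *\<^sub>C v k)" for j
  \<comment> \<open>Averaging: by Parseval the \<open>n\<close> squared norms add up to at least
    \<open>n * (n / 4)\<close>, so they cannot all lie below \<open>n / 4\<close>.\<close>
  have "\<exists>j<n. (norm (y j))\<^sup>2 \<ge> n / 4"
  proof (rule ccontr)
    assume "\<not> (\<exists>j<n. (norm (y j))\<^sup>2 \<ge> n / 4)"
    then have "(\<Sum>j<n. (norm (y j))\<^sup>2) < (\<Sum>j<n. real n / 4)"
      using n by (intro sum_strict_mono) (auto simp: not_le)
    moreover have "(\<Sum>j<n. (norm (y j))\<^sup>2) = real n * (\<Sum>k<n. (norm (v k))\<^sup>2)"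
      unfolding y_def a_def by (rule parseval_roots_of_unity)
    moreover have "(\<Sum>k<n. (norm (v k))\<^sup>2) \<ge> (\<Sum>k<n. (1 / 2)\<^sup>2)"
      using large by (intro sum_mono power_mono) auto
    then have "real n * (\<Sum>k<n. (norm (v k))\<^sup>2) \<ge> real n * (\<Sum>k<n. (1 / 2)\<^sup>2)"
      by (rule mult_left_mono) simp
    ultimately show False by (simp add: power2_eq_square)
  qed
  then obtain j where j: "(norm (y j))\<^sup>2 \<ge> n / 4" by blast
  define w where "w = cnj (a j)"
  have wa: "w * a j = 1"
    by (simp add: w_def a_def cis_cnj cis_mult)
  have norms: "cmod w = 1" "cmod (a j) = 1"
    by (auto simp: w_def a_def)
  \<comment> \<open>\<open>g k\<close> is the \<open>k\<close>-th summand of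
    \<open>(of_real c * w) *\<^sub>C y j\<close>. As \<open>w\<close> is inverse to
    \<open>a j\<close>, \<open>T\<close> sends the \<open>k\<close>-th summand of \<open>y j\<close>
    to \<open>g (Suc k)\<close>, so the difference telescopes.\<close>
  define g where "g k = (of_real c * w * a j ^ k) *\<^sub>C v k" for k
  have "T (y j) - (of_real c * w) *\<^sub>C y j = (\<Sum>k<n. g (Suc k) - g k)"
  proof -
    have "T ((a j ^ k) *\<^sub>C v k) = g (Suc k)" for k
    proof -
      have "of_real c * w * a j ^ Suc k = a j ^ k * of_real c * (w * a j)"
        by (simp add: mult_ac)
      also have "\<dots> = a j ^ k * of_real c" by (simp add: wa)
      finally show ?thesis
        unfolding g_def
        by (simp only: bounded_clinear_scaleC[OF T] orbit scaleC_scaleC[symmetric] scaleC_of_real)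
    qed
    then show ?thesis
      unfolding y_def by (simp add: T.sum scaleC_sum_right scaleC_scaleC g_def sum_subtractf)
  qed
  also have "\<dots> = g n - g 0"
    by (rule sum_lessThan_telescope)
  finally have "norm (T (y j) - (of_real c * w) *\<^sub>C y j) \<le> norm (g n) + norm (g 0)"
    by (simp add: norm_triangle_ineq4)
  also have "\<dots> = c * norm (v n) + c * norm (v 0)"
    using c by (simp add: g_def norm_scaleC norm_mult norm_power norms)
  also have "\<dots> \<le> c * 1 + c * 1"
    using c ends by (intro add_mono mult_left_mono) auto
  finally have res: "norm (T (y j) - (of_real c * w) *\<^sub>C y j) \<le> 2 * c" by simp
  have "sqrt (real n / 4) \<le> norm (y j)"
    using real_sqrt_le_mono[OF j] by simp
  then have ny: "sqrt n / 2 \<le> norm (y j)"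
    by (simp add: real_sqrt_divide)
  have sn: "sqrt n > 0" using n by simp
  then have pos: "norm (y j) > 0" using ny by linarith
  define u where "u = (1 / norm (y j)) *\<^sub>R y j"
  have "norm u = 1" using pos by (simp add: u_def)
  moreover have "norm (T u - (of_real c * w) *\<^sub>C u) \<le> 4 * c / sqrt n"
  proof -
    have "T u - (of_real c * w) *\<^sub>C u = (1 / norm (y j)) *\<^sub>R (T (y j) - (of_real c * w) *\<^sub>C y j)"
      unfolding u_def by (simp add: T.scaleR scaleC_scaleR scaleR_diff_right)
    then have "norm (T u - (of_real c * w) *\<^sub>C u) = norm (T (y j) - (of_real c * w) *\<^sub>C y j) / norm (y j)"
      by simp
    also have "\<dots> \<le> 2 * c / (sqrt n / 2)"
      using res ny sn c by (intro frac_le) auto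
    finally show ?thesis by simp
  qed
  ultimately show ?thesis using norms by blast
qed

text \<open>The inequality \<open>par\<close> at \<open>(T ^^ k) x\<close> says that the growth
  ratio of the norms along the orbit does not decrease, so a lower bound for the first ratio
  persists.\<close>

lemma paranormal_orbit_growth:
  fixes T :: "'a::real_normed_vector \<Rightarrow> 'a"
  assumes par: "\<And>x. (norm (T x))\<^sup>2 \<le> norm (T (T x)) * norm x"
    and T0: "T 0 = 0" and b: "b * norm x \<le> norm (T x)"
  shows "b * norm ((T ^^ k) x) \<le> norm ((T ^^ Suc k) x)"
proof (induction k)
  case 0
  then show ?case using b by simp
next
  case (Suc k)
  let ?y = "(T ^^ k) x"
  show ?case
  \<comment> \<open>If the orbit has reached 0, both sides vanish; otherwise \<open>norm ?y\<close>
    is positive and can be cancelled.\<close>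
  proof (cases "T ?y = 0")
    case True
    then show ?thesis using T0 by simp
  next
    case False
    then have pos: "norm ?y > 0" using T0 by auto
    have "(b * norm (T ?y)) * norm ?y = (b * norm ?y) * norm (T ?y)" by simp
    also have "\<dots> \<le> norm (T ?y) * norm (T ?y)"
      using Suc by (intro mult_right_mono) auto
    also have "\<dots> \<le> norm (T (T ?y)) * norm ?y"
      using par[of ?y] by (simp add: power2_eq_square)
    finally show ?thesis using pos by simp
  qed
qed

lemma paranormal_approximate_eigenvector:
  fixes T :: "'a::complex_hilbert \<Rightarrow> 'a"
    and n :: nat
  assumes T: "bounded_clinear T" and par: "\<And>x. (norm (T x))\<^sup>2 \<le> norm (T (T x)) * norm x"
    and pos: "onorm T > 0" and n: "n > 0"
  shows "\<exists>w u. cmod w = 1 \<and> norm u = 1 \<and>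
    norm (T u - (of_real (onorm T) * w) *\<^sub>C u) \<le> 4 * onorm T / sqrt n"
proof -
  interpret T: bounded_linear T
    using T by (rule bounded_clinear_imp_bounded_linear)
  define c where "c = onorm T"
  \<comment> \<open>Chosen so that Bernoulli's inequality gives
    \<open>r ^ k \<ge> 1 - k / (2 * n) \<ge> 1 / 2\<close> for all \<open>k < n\<close>.\<close>
  define r where "r = 1 - 1 / (2 * real n)"
  have c: "c > 0" using pos by (simp add: c_def)
  have r: "0 \<le> r" "r < 1" using n by (auto simp: r_def field_simps)
  \<comment> \<open>Since \<open>r * c\<close> is smaller than the operator norm, it cannot bound
    \<open>T\<close>.\<close>
  have "\<exists>x. norm (T x) > (r * c) * norm x"
  proof (rule ccontr)
    assume "\<not> ?thesis"
    then have "onorm T \<le> r * c"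
      using r c by (intro onorm_bound) (auto simp: not_less)
    moreover have "r * c < 1 * c" using r c by (intro mult_strict_right_mono) auto
    ultimately show False by (simp add: c_def)
  qed
  then obtain x' where x': "norm (T x') > (r * c) * norm x'" by blast
  then have "x' \<noteq> 0" by (auto simp: T.zero)
  define x where "x = (1 / norm x') *\<^sub>R x'"
  have nx: "norm x = 1" using \<open>x' \<noteq> 0\<close> by (simp add: x_def)
  have Tx: "(r * c) * norm x \<le> norm (T x)"
    using x' \<open>x' \<noteq> 0\<close> by (simp add: nx) (simp add: x_def T.scaleR field_simps)
  define v where "v k = (1 / c ^ k) *\<^sub>R (T ^^ k) x" for k
  have orbit: "T (v k) = c *\<^sub>R v (Suc k)" for k
    using c by (simp add: v_def T.scaleR)
  have upper: "norm ((T ^^ k) x) \<le> c ^ k" for k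
  proof (induction k)
    case (Suc k)
    have "norm (T ((T ^^ k) x)) \<le> c * norm ((T ^^ k) x)"
      unfolding c_def by (rule onorm) (rule T.bounded_linear_axioms)
    also have "\<dots> \<le> c * c ^ k" using Suc c by (intro mult_left_mono) auto
    finally show ?case by simp
  qed (simp add: nx)
  have lower: "(r * c) ^ k \<le> norm ((T ^^ k) x)" for k
  proof (induction k)
    case (Suc k)
    have "(r * c) ^ Suc k \<le> (r * c) * norm ((T ^^ k) x)"
      using Suc r c by (simp add: mult_left_mono)
    also have "\<dots> \<le> norm ((T ^^ Suc k) x)"
      by (rule paranormal_orbit_growth[where T = T, OF par T.zero Tx])
    finally show ?case .
  qed (simp add: nx)
  have "norm (v 0) \<le> 1" by (simp add: v_def nx)
  moreover have "norm (v n) \<le> 1" using upper[of n] c by (simp add: v_def)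
  moreover have "norm (v k) \<ge> 1 / 2" if "k < n" for k
  proof -
    have "1 / 2 \<le> 1 + real k * (- 1 / (2 * real n))"
      using that n by (simp add: field_simps)
    also have "\<dots> \<le> (1 + (- 1 / (2 * real n))) ^ k"
      using n by (intro Bernoulli_inequality) (simp add: field_simps)
    also have "\<dots> = r ^ k" by (simp add: r_def)
    also have "\<dots> \<le> norm ((T ^^ k) x) / c ^ k"
      using lower[of k] c by (simp add: power_mult_distrib field_simps)
    also have "\<dots> = norm (v k)"
      using c by (simp add: v_def)
    finally show ?thesis .
  qed
  ultimately show ?thesis
    using approximate_eigenvector_of_orbit[where v = v, OF T n less_imp_le[OF c]] orbit
    unfolding c_def by blast
qed

text \<open>The unimodular factor \<open>w n\<close> of the approximate eigenvalue varies with
  \<open>n\<close>; compactness of the circle gives a subsequence along which it converges, and the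
  limit provides one fixed \<open>z\<close>.\<close>

lemma paranormal_approximate_point_spectrum:
  fixes T :: "'a::complex_hilbert \<Rightarrow> 'a"
  assumes T: "bounded_clinear T" and par: "\<And>x. (norm (T x))\<^sup>2 \<le> norm (T (T x)) * norm x"
    and pos: "onorm T > 0"
  shows "\<exists>z\<in>approximate_point_spectrum T. cmod z = onorm T"
proof -
  define c where "c = onorm T"
  have "\<forall>n. \<exists>w u. cmod w = 1 \<and> norm u = 1 \<and>
      norm (T u - (of_real c * w) *\<^sub>C u) \<le> 4 * c / sqrt (real (Suc n))"
    unfolding c_def using paranormal_approximate_eigenvector[OF T par pos] by blast
  then obtain w u where w: "\<And>n. cmod (w n) = 1" and u: "\<And>n. norm (u n) = 1"
    and wu: "\<And>n. norm (T (u n) - (of_real c * w n) *\<^sub>C u n) \<le> 4 * c / sqrt (real (Suc n))"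
    by metis
  have "\<forall>n. w n \<in> sphere 0 1" by (simp add: w)
  then obtain l s where l: "l \<in> sphere 0 1" and s: "strict_mono s" and lim: "(w \<circ> s) \<longlonglongrightarrow> l"
    using compact_sphere[of "0::complex" 1] unfolding compact_def by blast
  have "(\<lambda>n. 4 * c / sqrt (real (Suc n))) \<longlonglongrightarrow> 0"
  proof -
    have "(\<lambda>n. 4 * c * sqrt (1 / real (Suc n))) \<longlonglongrightarrow> 4 * c * sqrt 0"
      by (intro tendsto_intros LIMSEQ_Suc[OF lim_1_over_n])
    then show ?thesis by (simp add: real_sqrt_divide)
  qed
  then have "(\<lambda>n. T (u n) - (of_real c * w n) *\<^sub>C u n) \<longlonglongrightarrow> 0"
    by (rule Lim_null_comparison[rotated]) (use wu in auto)
  then have "((\<lambda>n. T (u n) - (of_real c * w n) *\<^sub>C u n) \<circ> s) \<longlonglongrightarrow> 0"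
    using s by (rule LIMSEQ_subseq_LIMSEQ)
  then have 1: "(\<lambda>n. T (u (s n)) - (of_real c * w (s n)) *\<^sub>C u (s n)) \<longlonglongrightarrow> 0"
    by (simp add: o_def)
  \<comment> \<open>Replacing \<open>w (s n)\<close> by its limit costs exactly the modulus of this
    difference, because the vectors \<open>u (s n)\<close> are unit vectors.\<close>
  have "(\<lambda>n. of_real c * w (s n) - of_real c * l) \<longlonglongrightarrow> of_real c * l - of_real c * l"
    using lim by (intro tendsto_intros) (simp add: o_def)
  then have "(\<lambda>n. norm (of_real c * w (s n) - of_real c * l)) \<longlonglongrightarrow> 0"
    using tendsto_norm_zero by fastforce
  then have "(\<lambda>n. (of_real c * w (s n) - of_real c * l) *\<^sub>C u (s n)) \<longlonglongrightarrow> 0"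
    by (intro tendsto_norm_zero_cancel[of "\<lambda>n. (of_real c * w (s n) - of_real c * l) *\<^sub>C u (s n)"])
      (simp add: norm_scaleC u)
  from tendsto_add[OF 1 this] have "(\<lambda>n. T (u (s n)) - (of_real c * l) *\<^sub>C u (s n)) \<longlonglongrightarrow> 0"
    by (simp add: scaleC_diff_left)
  then have "of_real c * l \<in> approximate_point_spectrum T"
    unfolding approximate_point_spectrum_def using u by (auto intro!: exI[of _ "u \<circ> s"])
  moreover have "cmod (of_real c * l) = onorm T"
    using l pos by (simp add: norm_mult c_def)
  ultimately show ?thesis by blast
qed

section \<open>Words in an operator and its adjoint\<close>

lemma foldr_comp_append: "foldr (\<circ>) (us @ vs) id = foldr (\<circ>) us id \<circ> foldr (\<circ>) vs id"
  by (induction us) (auto simp: o_assoc)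

lemma SI_star_semigroup_imp_word:
  fixes T :: "'a::complex_hilbert \<Rightarrow> 'a"
  assumes "SI_semigroup (star_semigroup T)" and "\<not> selfadjoint T"
  shows "\<exists>ws. set ws \<subseteq> {T, cadjoint T} \<and> 2 \<le> length ws \<and> cadjoint T = foldr (\<circ>) ws id"
proof -
  \<comment> \<open>An operator may have several factorisations; membership asks for at least one
    word in which \<open>T\<close> occurs.\<close>
  define J where "J = {foldr (\<circ>) ws id | ws. T \<in> set ws \<and> set ws \<subseteq> {T, cadjoint T}}"
  have "semigroup_ideal J (star_semigroup T)"
    unfolding semigroup_ideal_def
  proof (intro conjI ballI)
    have T: "foldr (\<circ>) [T] id \<in> J"
      unfolding J_def by (intro CollectI exI[of _ "[T]"]) simp
    then show "J \<noteq> {}" by blast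
    show "J \<subseteq> star_semigroup T"
      unfolding J_def star_semigroup_def by fastforce
    fix A X assume "A \<in> J" "X \<in> star_semigroup T"
    then obtain us vs where *: "A = foldr (\<circ>) us id" "T \<in> set us" "set us \<subseteq> {T, cadjoint T}"
      "X = foldr (\<circ>) vs id" "set vs \<subseteq> {T, cadjoint T}"
      unfolding J_def star_semigroup_def by blast
    show "X \<circ> A \<in> J"
      unfolding J_def using * by (intro CollectI exI[of _ "vs @ us"]) (simp add: foldr_comp_append del: foldr_append)
    show "A \<circ> X \<in> J"
      unfolding J_def using * by (intro CollectI exI[of _ "us @ vs"]) (simp add: foldr_comp_append del: foldr_append)
  qed
  then have "cadjoint ` J \<subseteq> J"
    using assms(1) by (simp add: SI_semigroup_def)
  moreover have "T \<in> J"
    unfolding J_def by (intro CollectI exI[of _ "[T]"]) simp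
  ultimately have "cadjoint T \<in> J" by blast
  then obtain ws where ws: "cadjoint T = foldr (\<circ>) ws id" "T \<in> set ws" "set ws \<subseteq> {T, cadjoint T}"
    unfolding J_def by blast
  \<comment> \<open>A shorter word containing \<open>T\<close> is \<open>[T]\<close>, which would
    make \<open>T\<close> selfadjoint.\<close>
  have "2 \<le> length ws"
  proof (rule ccontr)
    assume "\<not> 2 \<le> length ws"
    then have "length ws \<le> 1" by simp
    then have "ws = [T]"
      using ws(2) by (cases ws) auto
    then show False using ws(1) assms(2) by (simp add: selfadjoint_def)
  qed
  with ws show ?thesis by blast
qed

text \<open>Approximate eigenvalues on a common sequence multiply along a word. Only moduli are
  tracked: for the letters \<open>T\<close> and \<open>cadjoint T\<close> the eigenvalues are
  conjugate, so the modulus depends on the length alone.\<close>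

lemma word_approximate_eigenvector:
  fixes X :: "nat \<Rightarrow> 'a::complex_hilbert"
  assumes letters: "\<And>A. A \<in> set ws \<Longrightarrow> bounded_clinear A \<and>
      (\<exists>\<mu>. cmod \<mu> = r \<and> (\<lambda>n. A (X n) - \<mu> *\<^sub>C X n) \<longlonglongrightarrow> 0)"
  shows "\<exists>\<mu>. cmod \<mu> = r ^ length ws \<and> (\<lambda>n. foldr (\<circ>) ws id (X n) - \<mu> *\<^sub>C X n) \<longlonglongrightarrow> 0"
  using assms
proof (induction ws)
  case Nil
  then show ?case by (intro exI[of _ 1]) simp
next
  case (Cons A ws)
  let ?W = "foldr (\<circ>) ws id"
  obtain \<mu> where \<mu>: "cmod \<mu> = r ^ length ws" "(\<lambda>n. ?W (X n) - \<mu> *\<^sub>C X n) \<longlonglongrightarrow> 0"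
    using Cons.IH[OF Cons.prems] list.set_intros(2) by metis
  obtain \<nu> where \<nu>: "cmod \<nu> = r" "(\<lambda>n. A (X n) - \<nu> *\<^sub>C X n) \<longlonglongrightarrow> 0" and A: "bounded_clinear A"
    using Cons.prems[of A] by auto
  interpret A: bounded_linear A
    using A by (rule bounded_clinear_imp_bounded_linear)
  have "(\<lambda>n. A (?W (X n) - \<mu> *\<^sub>C X n)) \<longlonglongrightarrow> 0"
    using \<mu>(2) by (rule A.tendsto_zero)
  moreover have "(\<lambda>n. \<mu> *\<^sub>C (A (X n) - \<nu> *\<^sub>C X n)) \<longlonglongrightarrow> 0"
    using tendsto_mult_right_zero[OF tendsto_norm_zero[OF \<nu>(2)], of "cmod \<mu>"]
    by (intro tendsto_norm_zero_cancel[of "\<lambda>n. \<mu> *\<^sub>C (A (X n) - \<nu> *\<^sub>C X n)"]) (simp add: norm_scaleC)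
  \<comment> \<open>The sum splits the error for \<open>A # ws\<close>: the error of
    \<open>ws\<close> pushed through the bounded \<open>A\<close>, plus the error of
    \<open>A\<close> scaled by \<open>\<mu>\<close>.\<close>
  ultimately have "(\<lambda>n. A (?W (X n) - \<mu> *\<^sub>C X n) + \<mu> *\<^sub>C (A (X n) - \<nu> *\<^sub>C X n)) \<longlonglongrightarrow> 0"
    using tendsto_add by fastforce
  then have "(\<lambda>n. foldr (\<circ>) (A # ws) id (X n) - (\<mu> * \<nu>) *\<^sub>C X n) \<longlonglongrightarrow> 0"
    by (simp add: A.diff bounded_clinear_scaleC[OF A] scaleC_diff_right scaleC_scaleC)
  moreover have "cmod (\<mu> * \<nu>) = r ^ length (A # ws)"
    using \<mu>(1) \<nu>(1) by (simp add: norm_mult)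
  ultimately show ?case by blast
qed

section \<open>The approximate point spectrum under the SI hypothesis\<close>

theorem lemma4p1:
  fixes T :: "'a::complex_hilbert \<Rightarrow> 'a"
  assumes "bounded_clinear T"
    and "\<not> selfadjoint T"
    and "hyponormal T"
    and "SI_semigroup (star_semigroup T)"
  shows "{0} \<noteq> approximate_point_spectrum T \<and>
    approximate_point_spectrum T \<subseteq> sphere 0 1 \<union> {0}"
proof
  note T = assms(1)
  have "onorm T > 0"
  proof -
    \<comment> \<open>The zero operator is its own adjoint, which nonselfadjointness
      excludes.\<close>
    have "T \<noteq> (\<lambda>x. 0)"
    proof
      assume "T = (\<lambda>x. 0)"
      then have 0: "T x = 0" for x by simp
      have "cadjoint T y = T y" for y
        by (rule cinner_eqI) (simp add: cadjoint[OF T, symmetric] 0)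
      then show False using assms(2) by (auto simp: selfadjoint_def)
    qed
    then show ?thesis
      using onorm_pos_lt[OF bounded_clinear_imp_bounded_linear[OF T]] by blast
  qed
  then obtain z where "z \<in> approximate_point_spectrum T" "z \<noteq> 0"
    using paranormal_approximate_point_spectrum[OF T hyponormal_imp_paranormal[OF T assms(3)]]
    by fastforce
  then show "{0} \<noteq> approximate_point_spectrum T" by blast
next
  note T = assms(1)
  obtain ws where ws: "set ws \<subseteq> {T, cadjoint T}" "2 \<le> length ws" "cadjoint T = foldr (\<circ>) ws id"
    using SI_star_semigroup_imp_word[OF assms(4,2)] by blast
  show "approximate_point_spectrum T \<subseteq> sphere 0 1 \<union> {0}"
  proof
    fix z assume "z \<in> approximate_point_spectrum T"
    then obtain X where X: "\<And>n. norm (X n) = 1" and TX: "(\<lambda>n. T (X n) - z *\<^sub>C X n) \<longlonglongrightarrow> 0"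
      unfolding approximate_point_spectrum_def by blast
    \<comment> \<open>The same unit vectors serve \<open>cadjoint T\<close>, by domination through
      \<open>hyponormal_shift\<close>.\<close>
    have SX: "(\<lambda>n. cadjoint T (X n) - cnj z *\<^sub>C X n) \<longlonglongrightarrow> 0"
      using hyponormal_shift[OF T assms(3)]
      by (intro Lim_null_comparison[OF _ tendsto_norm_zero[OF TX]] always_eventually) auto
    have "bounded_clinear A \<and> (\<exists>\<mu>. cmod \<mu> = cmod z \<and> (\<lambda>n. A (X n) - \<mu> *\<^sub>C X n) \<longlonglongrightarrow> 0)"
      if "A \<in> set ws" for A
    proof -
      have "A = T \<or> A = cadjoint T" using that ws(1) by blast
      then show ?thesis
        using T bounded_clinear_cadjoint[OF T] TX SX complex_mod_cnj[of z] by metis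
    qed
    from word_approximate_eigenvector[OF this]
    obtain \<mu> where \<mu>: "cmod \<mu> = cmod z ^ length ws" "(\<lambda>n. cadjoint T (X n) - \<mu> *\<^sub>C X n) \<longlonglongrightarrow> 0"
      using ws(3) by metis
    \<comment> \<open>Both \<open>\<mu>\<close> and \<open>cnj z\<close> are approximate eigenvalues
      of \<open>cadjoint T\<close> on \<open>X\<close>. As the \<open>X n\<close> are unit vectors,
      the norms here form a constant sequence, so the two coincide.\<close>
    have "(\<lambda>n. (\<mu> - cnj z) *\<^sub>C X n) \<longlonglongrightarrow> 0"
      using tendsto_diff[OF SX \<mu>(2)] by (simp add: scaleC_diff_left)
    then have "(\<lambda>n. cmod (\<mu> - cnj z)) \<longlonglongrightarrow> 0"
      using tendsto_norm_zero by (fastforce simp: norm_scaleC X)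
    then have "\<mu> = cnj z" by (simp add: LIMSEQ_const_iff)
    with \<mu>(1) have eq: "cmod z = cmod z ^ length ws" by simp
    \<comment> \<open>Length at least 2 leaves a positive exponent \<open>k\<close> after one factor
      \<open>cmod z\<close> is cancelled, which forces modulus 1.\<close>
    obtain k where k: "length ws = Suc k" "k > 0"
      using ws(2) by (cases "length ws") auto
    have "cmod z = 1" if "z \<noteq> 0"
    proof -
      have "cmod z ^ k = 1" using eq k that by simp
      then show ?thesis using k(2) power_eq_imp_eq_base[of "cmod z" k 1] by simp
    qed
    then show "z \<in> sphere 0 1 \<union> {0}" by auto
  qed
qed

end
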